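(* Let $h(x)$ be a polynomial with real coefficients. For every integer $n\ge 0$ and every real $x$, the $h(x)$-Lucas polynomial $L_{n,h}$ satisfies $$L_{n,h}(x)=\frac{i^{n}}{2^{n-1}}\left(\sqrt{h^{2}(x)+4}\right)^{n}\alpha_{n}\left(\frac{-i\,h(x)}{\sqrt{h^{2}(x)+4}}\right)=\frac{1}{2^{n-1}}\sum_{k=0}^{\lfloor n/2\rfloor}\binom{n}{2k}h^{n-2k}(x)\left(h^{2}(x)+4\right)^{k}.$$
   Context: For each integer $n\ge 0$, $\alpha_n$ is the polynomial $\alpha_n(y)=\sum_{k=0}^{\lfloor n/2\rfloor}(-1)^k\binom{n}{2k}y^{n-2k}$ (so $\alpha_n(y)=\operatorname{Re}((y+i)^{n})$ for real $y$); it is evaluated at complex arguments as a polynomial. The $h(x)$-Lucas polynomials are given by $L_{n,h}(x)=2i^{n}T_{n}\left(\frac{h(x)}{2i}\right)$, where $T_n$ is the Chebyshev polynomial of the first kind, $T_n(\cos\theta)=\cos(n\theta)$ (equivalently $L_{0,h}=2$, $L_{1,h}=h$, $L_{n+1,h}=hL_{n,h}+L_{n-1,h}$). Here $h^m(x)$ means $(h(x))^m$. *)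

theory Defs
  imports "HOL-Analysis.Analysis" "HOL-Computational_Algebra.Polynomial"
begin

definition chebyshev_T :: "nat \<Rightarrow> real poly" where
  "chebyshev_T n = (THE p. \<forall>\<theta>. poly p (cos \<theta>) = cos (real n * \<theta>))"

lemma chebyshev_T_ex1: "\<exists>!p::real poly. \<forall>\<theta>. poly p (cos \<theta>) = cos (real n * \<theta>)"
proof (rule ex_ex1I)
  have "(\<exists>p::real poly. \<forall>\<theta>. poly p (cos \<theta>) = cos (real n * \<theta>)) \<and>
        (\<exists>p::real poly. \<forall>\<theta>. poly p (cos \<theta>) = cos (real (Suc n) * \<theta>))"
  proof (induction n)
    case 0
    have "\<forall>\<theta>. poly 1 (cos \<theta>) = cos (real 0 * \<theta>)"
      and "\<forall>\<theta>. poly [:0, 1:] (cos \<theta>) = cos (real (Suc 0) * \<theta>)"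
      by simp_all
    then show ?case by blast
  next
    case (Suc n)
    then obtain p q :: "real poly"
      where p: "\<And>\<theta>. poly p (cos \<theta>) = cos (real n * \<theta>)"
        and q: "\<And>\<theta>. poly q (cos \<theta>) = cos (real (Suc n) * \<theta>)"
      by blast
    have "poly ([:0, 2:] * q - p) (cos \<theta>) = cos (real (Suc (Suc n)) * \<theta>)" for \<theta>
    proof -
      have "cos (real (Suc (Suc n)) * \<theta>) = cos (real (Suc n) * \<theta> + \<theta>)"
        by (simp add: algebra_simps)
      moreover have "cos (real n * \<theta>) = cos (real (Suc n) * \<theta> - \<theta>)"
        by (simp add: algebra_simps)
      ultimately show ?thesis
        unfolding poly_diff poly_mult p q cos_add cos_diff by simp
    qed
    with Suc show ?case by blast
  qed
  then show "\<exists>p::real poly. \<forall>\<theta>. poly p (cos \<theta>) = cos (real n * \<theta>)" by blast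
next
  fix p q :: "real poly"
  assume p: "\<forall>\<theta>. poly p (cos \<theta>) = cos (real n * \<theta>)"
    and q: "\<forall>\<theta>. poly q (cos \<theta>) = cos (real n * \<theta>)"
  have "{-1..1} \<subseteq> {y. poly (p - q) y = 0}"
  proof
    fix y :: real assume "y \<in> {-1..1}"
    then have "y = cos (arccos y)" by simp
    then have "poly p y = poly q y" using p q by metis
    then show "y \<in> {y. poly (p - q) y = 0}" by simp
  qed
  moreover have "infinite {-1..(1::real)}" by (simp add: infinite_Icc)
  ultimately have "p - q = 0" using poly_roots_finite finite_subset by blast
  then show "p = q" by simp
qed

lemma poly_chebyshev_T_cos: "poly (chebyshev_T n) (cos \<theta>) = cos (real n * \<theta>)"
  using theI'[OF chebyshev_T_ex1[of n]] unfolding chebyshev_T_def by blast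

definition lucas_poly :: "nat \<Rightarrow> real poly \<Rightarrow> complex poly" where
  "lucas_poly n h =
     smult (2 * \<i> ^ n)
       (pcompose (map_poly of_real (chebyshev_T n)) (smult (1 / (2 * \<i>)) (map_poly of_real h)))"

lemma poly_lucas_poly:
  "poly (lucas_poly n h) (of_real x) =
     2 * \<i> ^ n * poly (map_poly of_real (chebyshev_T n)) (of_real (poly h x) / (2 * \<i>))"
proof -
  have "poly (map_poly of_real h) (complex_of_real x) = of_real (poly h x)"
    by (induction h) (simp_all add: map_poly_pCons)
  then show ?thesis
    unfolding lucas_poly_def by (simp add: poly_pcompose)
qed

definition alpha_poly :: "nat \<Rightarrow> real poly" where
  "alpha_poly n = (\<Sum>k = 0..n div 2. monom ((-1) ^ k * real (n choose (2 * k))) (n - 2 * k))"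

end

theory Submission
  imports Defs
begin

text \<open>
  With \<open>S = sqrt (h\<^sup>2 + 4)\<close>, all three expressions equal the Binet form
  \<open>((h + S)^n + (h - S)^n) / 2^n\<close>: the first because \<open>2 T\<^sub>n(z) = (z + w)^n + (z - w)^n\<close> whenever
  \<open>w\<^sup>2 = z\<^sup>2 - 1\<close>, taken at \<open>z = h / (2 \<i>)\<close>, \<open>w = S / (2 \<i>)\<close>; the second because
  \<open>2 \<alpha>\<^sub>n(y) = (y + \<i>)^n + (y - \<i>)^n\<close>; the third by the binomial theorem.
\<close>

text \<open>By the uniqueness half of \<open>chebyshev_T_ex1\<close>, values at cosines suffice to
  identify \<open>chebyshev_T n\<close>; the base cases and the recurrence below rest on
  this.\<close>

lemma chebyshev_T_eqI:
  assumes "\<And>\<theta>. poly p (cos \<theta>) = cos (real n * \<theta>)"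
  shows "chebyshev_T n = p"
  using chebyshev_T_ex1[of n] assms poly_chebyshev_T_cos by blast

lemma chebyshev_T_0: "chebyshev_T 0 = 1"
  by (rule chebyshev_T_eqI) simp

lemma chebyshev_T_1: "chebyshev_T (Suc 0) = [:0, 1:]"
  by (rule chebyshev_T_eqI) simp

lemma chebyshev_T_rec:
  "chebyshev_T (Suc (Suc n)) = [:0, 2:] * chebyshev_T (Suc n) - chebyshev_T n"
proof (rule chebyshev_T_eqI)
  fix \<theta> :: real
  have "cos (real (Suc (Suc n)) * \<theta>) = cos (real (Suc n) * \<theta> + \<theta>)"
    and "cos (real n * \<theta>) = cos (real (Suc n) * \<theta> - \<theta>)"
    by (simp_all add: algebra_simps)
  then show "poly ([:0, 2:] * chebyshev_T (Suc n) - chebyshev_T n) (cos \<theta>)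
      = cos (real (Suc (Suc n)) * \<theta>)"
    unfolding poly_diff poly_mult poly_chebyshev_T_cos cos_add cos_diff by simp
qed

lemma map_poly_of_real_add:
  "map_poly of_real (p + q) = (map_poly of_real p + map_poly of_real q :: 'a::real_algebra_1 poly)"
  by (rule poly_eqI) (simp add: coeff_map_poly)

lemma map_poly_of_real_diff:
  "map_poly of_real (p - q) = (map_poly of_real p - map_poly of_real q :: 'a::real_algebra_1 poly)"
  by (rule poly_eqI) (simp add: coeff_map_poly)

lemma map_poly_of_real_smult:
  "map_poly of_real (smult c p) =
     smult (of_real c) (map_poly of_real p :: 'a::{real_algebra_1,comm_ring_1} poly)"
  by (rule poly_eqI) (simp add: coeff_map_poly)

lemma map_poly_of_real_sum:
  "map_poly of_real (\<Sum>k\<in>A. f k) = (\<Sum>k\<in>A. map_poly of_real (f k) :: 'a::real_algebra_1 poly)"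
  by (induction A rule: infinite_finite_induct) (simp_all add: map_poly_of_real_add)

text \<open>Both sides obey the same three-term recurrence and agree for n = 0 and n = 1. Taking any
  square root \<open>w\<close> avoids choosing a branch of the complex root.\<close>

lemma two_chebyshev_T_eq:
  fixes z w :: complex
  assumes w: "w\<^sup>2 = z\<^sup>2 - 1"
  shows "2 * poly (map_poly of_real (chebyshev_T n)) z = (z + w) ^ n + (z - w) ^ n"
proof (induction n rule: induct_nat_012)
  case 0
  show ?case by (simp add: chebyshev_T_0)
next
  case 1
  show ?case by (simp add: chebyshev_T_1 map_poly_pCons)
next
  case (ge2 n)
  \<comment> \<open>\<open>z + w\<close> and \<open>z - w\<close> are the roots of the characteristic polynomial
      \<open>t\<^sup>2 - 2 z t + 1\<close> of the Chebyshev recurrence.\<close>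
  have root: "u ^ Suc (Suc n) = 2 * z * u ^ Suc n - u ^ n" if "u\<^sup>2 = 2 * z * u - 1" for u
  proof -
    have "u ^ Suc (Suc n) = u ^ n * u\<^sup>2"
      by (simp add: power2_eq_square)
    then show ?thesis by (simp add: that algebra_simps)
  qed
  have plus: "(z + w) ^ Suc (Suc n) = 2 * z * (z + w) ^ Suc n - (z + w) ^ n"
    using w by (intro root) (simp add: power2_eq_square algebra_simps)
  have minus: "(z - w) ^ Suc (Suc n) = 2 * z * (z - w) ^ Suc n - (z - w) ^ n"
    using w by (intro root) (simp add: power2_eq_square algebra_simps)
  have rec: "poly (map_poly of_real (chebyshev_T (Suc (Suc n)))) z =
      2 * z * poly (map_poly of_real (chebyshev_T (Suc n))) z
        - poly (map_poly of_real (chebyshev_T n)) z"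
    by (simp add: chebyshev_T_rec map_poly_of_real_diff map_poly_of_real_smult map_poly_pCons)
  have "2 * poly (map_poly of_real (chebyshev_T (Suc (Suc n)))) z =
      2 * z * ((z + w) ^ Suc n + (z - w) ^ Suc n) - ((z + w) ^ n + (z - w) ^ n)"
    unfolding ge2[symmetric] rec by (simp add: algebra_simps)
  then show ?case
    unfolding plus minus by (simp add: algebra_simps del: power_Suc)
qed

text \<open>Odd powers of \<open>b\<close> cancel and even ones double. The generality over rings
  allows both the complex case \<open>b\<close> = i, for \<alpha>, and the real case
  \<open>b = S\<close>, for the final sum.\<close>

lemma binomial_add_diff:
  fixes a b :: "'a::comm_ring_1"
  shows "(a + b) ^ n + (a - b) ^ n =
    2 * (\<Sum>k = 0..n div 2. of_nat (n choose (2 * k)) * a ^ (n - 2 * k) * (b\<^sup>2) ^ k)"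
proof -
  let ?f = "\<lambda>j. of_nat (n choose j) * b ^ j * a ^ (n - j) + of_nat (n choose j) * (- b) ^ j * a ^ (n - j)"
  have even: "?f (2 * k) = 2 * (of_nat (n choose (2 * k)) * a ^ (n - 2 * k) * (b\<^sup>2) ^ k)" for k
    unfolding power_mult power2_minus by (simp add: mult_ac)
  have "(a + b) ^ n + (a - b) ^ n = (\<Sum>j\<le>n. ?f j)"
    using binomial_ring[of b a n] binomial_ring[of "- b" a n]
    by (simp add: sum.distrib add.commute)
  \<comment> \<open>An even index up to \<open>n\<close> is 2k with k at most
    \<open>n div 2\<close>, so only odd indices are dropped.\<close>
  also have "\<dots> = (\<Sum>j\<in>(*) 2 ` {0..n div 2}. ?f j)"
  proof (rule sum.mono_neutral_right)
    show "\<forall>j\<in>{..n} - (*) 2 ` {0..n div 2}. ?f j = 0"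
    proof
      fix j assume j: "j \<in> {..n} - (*) 2 ` {0..n div 2}"
      have "odd j"
      proof
        assume "even j"
        then obtain k where "j = 2 * k" ..
        with j show False by auto
      qed
      then show "?f j = 0" by simp
    qed
  qed auto
  also have "\<dots> = (\<Sum>k = 0..n div 2. ?f (2 * k))"
    by (subst sum.reindex) (simp_all add: inj_on_def)
  finally show ?thesis unfolding even by (simp add: sum_distrib_left)
qed

text \<open>In \<open>binomial_add_diff\<close> with \<open>b\<close> = i, the factor (i^2)^k is the
  alternating sign of \<alpha>.\<close>

lemma two_alpha_poly_eq:
  fixes y :: complex
  shows "2 * poly (map_poly of_real (alpha_poly n)) y = (y + \<i>) ^ n + (y - \<i>) ^ n"
  unfolding binomial_add_diff alpha_poly_def
  by (simp add: map_poly_of_real_sum poly_sum map_poly_monom poly_monom mult_ac)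

theorem mainTheorem8:
  fixes h :: "real poly" and n :: nat and x :: real
  shows "poly (lucas_poly n h) (of_real x) =
           \<i> ^ n / 2 powi (int n - 1) * of_real (sqrt ((poly h x)\<^sup>2 + 4)) ^ n *
             poly (map_poly of_real (alpha_poly n))
               (- \<i> * of_real (poly h x) / of_real (sqrt ((poly h x)\<^sup>2 + 4)))
       \<and> \<i> ^ n / 2 powi (int n - 1) * of_real (sqrt ((poly h x)\<^sup>2 + 4)) ^ n *
             poly (map_poly of_real (alpha_poly n))
               (- \<i> * of_real (poly h x) / of_real (sqrt ((poly h x)\<^sup>2 + 4)))
         = of_real (1 / 2 powi (int n - 1) *
             (\<Sum>k = 0..n div 2. real (n choose (2 * k)) * poly h x ^ (n - 2 * k) *
                ((poly h x)\<^sup>2 + 4) ^ k))"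
    (is "?L = ?A \<and> ?A = ?B")
proof -
  define S where "S = sqrt ((poly h x)\<^sup>2 + 4)"
  define H where "H = poly h x"
  define s c where "s = complex_of_real S" and "c = complex_of_real H"
  define M where "M = ((c + s) ^ n + (c - s) ^ n) / 2 ^ n"
  have S2: "S\<^sup>2 = H\<^sup>2 + 4" and "S > 0"
    by (simp_all add: S_def H_def add_nonneg_pos)
  then have s0: "s \<noteq> 0" by (simp add: s_def)
  have s2: "s\<^sup>2 = c\<^sup>2 + 4"
    using arg_cong[OF S2, of complex_of_real] by (simp add: s_def c_def)
  \<comment> \<open>The exponent is -1 when n = 0, hence \<open>powi\<close>. The fact is
    polymorphic, serving \<open>?A\<close> over the complex numbers and \<open>?B\<close> over the
    reals.\<close>
  have two: "2 powi (int n - 1) = (2 ^ n / 2 :: 'a::{field_char_0})"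
    by (simp add: power_int_diff)

  \<comment> \<open>With z = c/(2i) and w = s/(2i), w^2 = -(c^2 + 4)/4 = z^2 - 1.\<close>
  have "?L = \<i> ^ n * ((c / (2 * \<i>) + s / (2 * \<i>)) ^ n + (c / (2 * \<i>) - s / (2 * \<i>)) ^ n)"
    unfolding poly_lucas_poly
    by (subst two_chebyshev_T_eq[symmetric])
      (simp_all add: s2 c_def H_def power_divide field_simps)
  \<comment> \<open>Moving i^n inside the powers cancels the i in each denominator, leaving (c +
    s)/2 and (c - s)/2.\<close>
  also have "\<dots> = M"
    unfolding M_def
    by (simp add: distrib_left power_mult_distrib[symmetric] power_divide[symmetric]
        algebra_simps add_divide_distrib diff_divide_distrib)
  finally have L: "?L = M" .

  \<comment> \<open>Dividing by 2^(n-1) supplies the 2 that \<open>two_alpha_poly_eq\<close> needs.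
    Absorbing (is)^n into the powers then clears the denominator \<open>s\<close>, and since i^2 =
    -1 the two summands of \<open>M\<close> appear in swapped order.\<close>
  have "?A = (\<i> * s) ^ n * (2 * poly (map_poly of_real (alpha_poly n)) (- \<i> * c / s)) / 2 ^ n"
    by (simp add: two s_def c_def S_def H_def power_mult_distrib)
  also have "\<dots> = ((\<i> * s * (- \<i> * c / s + \<i>)) ^ n + (\<i> * s * (- \<i> * c / s - \<i>)) ^ n) / 2 ^ n"
    unfolding two_alpha_poly_eq by (simp only: distrib_left[of _ "_ ^ n"] power_mult_distrib)
  also have "\<i> * s * (- \<i> * c / s + \<i>) = c - s"
    using s0 by (simp add: field_simps)
  also have "\<i> * s * (- \<i> * c / s - \<i>) = c + s"
    using s0 by (simp add: field_simps)
  finally have A: "?A = M" by (simp add: M_def add.commute)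

  \<comment> \<open>Here \<open>b = S\<close>, so its square is the real number H^2 + 4 of the sum;
    only the result is cast to the complex numbers.\<close>
  have "?B = of_real (((H + S) ^ n + (H - S) ^ n) / 2 ^ n)"
    unfolding binomial_add_diff S2 by (simp add: two H_def)
  then have "?B = M" by (simp add: M_def s_def c_def)
  with L A show ?thesis by simp
qed

end
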